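(* Let $\{k_i(t)\}_{t=i,i+1,\dots}$ ($i=1,2,\dots$) be multiple growing network Markov chains with initial distributions $d_{k,i}$ and transition functions $f_t(k)$, $o_{k,l}(\frac1t)$. Suppose that for every $k$ the limit $\lim_{i\to\infty}d_{k,i}=d_k$ exists, that $\sum_{k=0}^\infty d_k=1$, and that for every $k$ the (finite) limit $F(k):=\lim_{t\to\infty}t f_t(k)$ exists. Suppose that there is a non-negative integer $m$ such that $d_k=0$ for $k=0,1,\dots,m-1$, $d_m>0$, and $F(k)>0$ for $k=m,m+1,\dots$. Suppose moreover that there is an integer $M\ge m$ with $d_k=0$ for all $k>M$, and that there are two constants $A,B$ with $F(k)=Ak+B$ for all $k$. Write $P(k)=\lim_{t\to\infty}P(k,t)$. Then: (I) The degree distribution $P(k)$ satisfies $\sum_{k=m}^\infty P(k)=1$. (II) If $A>0$, then $\{k_i(t)\}$ are scale-free multiple growing network Markov chains, and $$P(k)=\begin{cases}\dfrac{d_m}{1+Am+B}, & k=m,\\[2mm] \displaystyle\prod_{i=m}^{k-1}\frac{Ai+B}{1+A(i+1)+B}\left[\frac{d_m}{1+Am+B}+\sum_{l=m}^{k-1}\frac{\frac{d_{l+1}}{1+A(l+1)+B}}{\prod_{j=m}^{l}\frac{Aj+B}{1+A(j+1)+B}}\right], & m<k\le M,\\[4mm] \displaystyle\frac{\Gamma(k+\frac BA)}{\Gamma(k+\frac BA+1+\frac1A)}\,\frac{\Gamma(M+\frac BA+1+\frac1A)}{\Gamma(M+\frac BA)}\prod_{i=m}^{M-1}\frac{Ai+B}{1+A(i+1)+B}\left[\frac{d_m}{1+Am+B}+\sum_{l=m}^{M-1}\frac{\frac{d_{l+1}}{1+A(l+1)+B}}{\prod_{j=m}^{l}\frac{Aj+B}{1+A(j+1)+B}}\right],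 & k>M,\end{cases}$$ with $P(k)\sim k^{-(1+\frac1A)}$. In particular, if $d_m=1$ and $d_k=0$ for $k\ne m$, then $$P(k)=\begin{cases}\dfrac{1}{1+Am+B}, & k=m,\\[2mm] \displaystyle\frac{\Gamma(k+\frac BA)}{\Gamma(k+\frac BA+1+\frac1A)}\,\frac{\Gamma(m+\frac BA+1+\frac1A)}{\Gamma(m+\frac BA)}\,\frac{1}{1+Am+B}\ \sim\ k^{-(1+\frac1A)}, & k>m.\end{cases}$$ (III) If $A=0$ and $B>0$, then $\{k_i(t)\}$ are not scale-free multiple growing network Markov chains. (IV) The cases $A<0$, and $A=0,\ B<0$, cannot occur.
   Context: Multiple growing network Markov chains: for each $i=1,2,\dots$, $k_i(t)$ ($t=i,i+1,\dots$) is a Markov chain, non-decreasing in $t$, with values in $\{0,1,2,\dots\}$. There are a positive integer $i_0$ and a fixed positive integer $m'$ such that for all $i\ge i_0$ the chain has initial distribution $P\{k_i(i)=k\}=d_{k,i}$ and transition probabilities $p_{k,l}=P\{k_i(t+1)=l\mid k_i(t)=k\}$ as follows. Let $K=K(i,t)$ denote the maximum value that $k_i(t)$ can take. For $k\le K$, $$p_{k,l}=\begin{cases}1-f_t(k)-\sum_{s=k+2}^{k+m'}o_{k,s}(\frac1t), & l=k,\\ f_t(k), & l=k+1,\\ o_{k,l}(\frac1t), & k+1<l\le k+m',\\ 0,&\text{otherwise,}\end{cases}$$ and for $k>K$, $p_{k,l}=1$ if $l=k$ and $p_{k,l}=0$ if $l\ne k$. Here $f_t(k)$ and $o_{k,l}(\frac1t)$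 do not depend on $i$, and for each fixed $k,l$ the quantity $o_{k,l}(\frac1t)$ is a function of $t$ with $t\,o_{k,l}(\frac1t)\to0$ as $t\to\infty$. Notation: $P(k,i,t):=P\{k_i(t)=k\}$ for $t\ge i$, and $P(k,t):=\frac1t\sum_{i=1}^t P(k,i,t)$. Definition: if the limit $P(k)=\lim_{t\to\infty}P(k,t)$ exists for every $k\ge 0$, and $P(k)\ge 0$, $\sum_{k=0}^\infty P(k)=1$, one says that the steady degree distribution of $\{k_i(t)\}$ exists, and $P(k)$ is called the steady degree distribution. If moreover $P(k)$ is a power law, i.e. $P(k)\sim k^{-\gamma}$ for some constant $\gamma$, the chains are called scale-free. Here $P(k)\sim k^{-\gamma}$ means asymptotic proportionality: $k^{\gamma}P(k)$ converges to a positive finite constant as $k\to\infty$. Empty products equal $1$ and empty sums equal $0$. *)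

theory Defs
  imports "HOL-Probability.Probability"
begin

definition markov_chain_from :: "'a measure \<Rightarrow> nat \<Rightarrow> (nat \<Rightarrow> 'a \<Rightarrow> nat) \<Rightarrow> bool" where
  "markov_chain_from \<mu> s Y \<longleftrightarrow>
     (\<forall>t\<ge>s. Y t \<in> measurable \<mu> (count_space UNIV)) \<and>
     (\<forall>t\<ge>s. \<forall>x l. \<P>(\<omega> in \<mu>. \<forall>u\<in>{s..t}. Y u \<omega> = x u) > 0 \<longrightarrow>
        \<P>(\<omega> in \<mu>. Y (t + 1) \<omega> = l \<bar> \<forall>u\<in>{s..t}. Y u \<omega> = x u)
          = \<P>(\<omega> in \<mu>. Y (t + 1) \<omega> = l \<bar> Y t \<omega> = x t))"

text \<open>Values taken with probability zero are not counted; the maximum is infinite if the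
  random variable is not almost surely bounded.\<close>

definition max_value :: "'a measure \<Rightarrow> ('a \<Rightarrow> nat) \<Rightarrow> enat" where
  "max_value \<mu> Y = (SUP k \<in> {k. \<P>(\<omega> in \<mu>. Y \<omega> = k) > 0}. enat k)"

text \<open>\<open>f t k\<close> is $f_t(k)$, and \<open>r k l t\<close> is the term $o_{k,l}(1/t)$.\<close>

definition growing_transition ::
  "enat \<Rightarrow> nat \<Rightarrow> (nat \<Rightarrow> nat \<Rightarrow> real) \<Rightarrow> (nat \<Rightarrow> nat \<Rightarrow> nat \<Rightarrow> real) \<Rightarrow> nat \<Rightarrow> nat \<Rightarrow> nat \<Rightarrow> real" where
  "growing_transition K m' f r t k l =
     (if enat k \<le> K then
        (if l = k then 1 - f t k - (\<Sum>s = k + 2..k + m'. r k s t)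
         else if l = k + 1 then f t k
         else if k + 1 < l \<and> l \<le> k + m' then r k l t
         else 0)
      else (if l = k then 1 else 0))"

text \<open>\<open>X i t\<close> is $k_i(t)$, relevant only for $1 \le i \le t$, and \<open>d k i\<close> is $d_{k,i}$.
  No joint law of different chains is prescribed. Transition probabilities are conditional
  probabilities, so they are constrained only at states of positive probability; the values of
  \<open>growing_transition\<close> at other states (in particular above the maximum) are a convention.\<close>

definition growing_network_chains ::
  "'a measure \<Rightarrow> (nat \<Rightarrow> nat \<Rightarrow> 'a \<Rightarrow> nat) \<Rightarrow> (nat \<Rightarrow> nat \<Rightarrow> real) \<Rightarrow> (nat \<Rightarrow> nat \<Rightarrow> real)
     \<Rightarrow> (nat \<Rightarrow> nat \<Rightarrow> nat \<Rightarrow> real) \<Rightarrow> bool" where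
  "growing_network_chains \<mu> X d f r \<longleftrightarrow>
     prob_space \<mu> \<and>
     (\<forall>i\<ge>1. markov_chain_from \<mu> i (X i)) \<and>
     (\<forall>i\<ge>1. \<forall>t\<ge>i. AE \<omega> in \<mu>. X i t \<omega> \<le> X i (t + 1) \<omega>) \<and>
     (\<exists>i\<^sub>0\<ge>1. \<exists>m'\<ge>1.
        (\<forall>i\<ge>i\<^sub>0. \<forall>k. \<P>(\<omega> in \<mu>. X i i \<omega> = k) = d k i) \<and>
        (\<forall>i\<ge>i\<^sub>0. \<forall>t\<ge>i. \<forall>k l. \<P>(\<omega> in \<mu>. X i t \<omega> = k) > 0 \<longrightarrow>
           \<P>(\<omega> in \<mu>. X i (t + 1) \<omega> = l \<bar> X i t \<omega> = k)
             = growing_transition (max_value \<mu> (X i t)) m' f r t k l) \<and>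
        (\<forall>k l. k + 1 < l \<and> l \<le> k + m' \<longrightarrow> (\<lambda>t. real t * r k l t) \<longlonglongrightarrow> 0))"

definition degree_freq :: "'a measure \<Rightarrow> (nat \<Rightarrow> nat \<Rightarrow> 'a \<Rightarrow> nat) \<Rightarrow> nat \<Rightarrow> nat \<Rightarrow> real" where
  "degree_freq \<mu> X k t = (1 / real t) * (\<Sum>i = 1..t. \<P>(\<omega> in \<mu>. X i t \<omega> = k))"

definition steady_degree_distribution ::
  "'a measure \<Rightarrow> (nat \<Rightarrow> nat \<Rightarrow> 'a \<Rightarrow> nat) \<Rightarrow> (nat \<Rightarrow> real) \<Rightarrow> bool" where
  "steady_degree_distribution \<mu> X P \<longleftrightarrow>
     (\<forall>k. (\<lambda>t. degree_freq \<mu> X k t) \<longlonglongrightarrow> P k) \<and> (\<forall>k. P k \<ge> 0) \<and> P sums 1"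

text \<open>$P(k) \sim k^{-\gamma}$ in the sense of asymptotic proportionality.\<close>

definition power_law :: "(nat \<Rightarrow> real) \<Rightarrow> real \<Rightarrow> bool" where
  "power_law P \<gamma> \<longleftrightarrow> (\<exists>c>0. (\<lambda>k. real k powr \<gamma> * P k) \<longlonglongrightarrow> c)"

definition scale_free :: "'a measure \<Rightarrow> (nat \<Rightarrow> nat \<Rightarrow> 'a \<Rightarrow> nat) \<Rightarrow> bool" where
  "scale_free \<mu> X \<longleftrightarrow> (\<exists>P. steady_degree_distribution \<mu> X P \<and> (\<exists>\<gamma>. power_law P \<gamma>))"

end

theory Submission
  imports Defs
begin

text \<open>
  Let \<open>S l t\<close> be the expected number of chains in state \<open>l\<close> at time \<open>t\<close>. Summing the one-step
  equations over all chains, \<open>S l (t + 1)\<close> is \<open>S l t\<close> reduced by a loss of about \<open>F l * S l t / t\<close>,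
  plus an inflow of about \<open>F (l - 1) * S (l - 1) t / t\<close> and the newborn mass \<open>d l (t + 1)\<close>. A
  recurrence of this averaging kind forces \<open>S l t / t\<close> to converge, so by induction on \<open>l\<close> the degree
  distribution exists and satisfies \<open>(1 + F l) * P l = F (l - 1) * P (l - 1) + dl l\<close>. This linear
  recurrence is solved explicitly. Summing it gives \<open>(\<Sum>k\<le>n. P k) + F n * P n = (\<Sum>k\<le>n. dl k)\<close>, so
  no mass escapes iff \<open>F n * P n\<close> tends to 0. For affine \<open>F\<close> the tail is a ratio of Pochhammer
  symbols if \<open>A > 0\<close>, and geometric if \<open>A = 0\<close>.
\<close>

section \<open>Convergence of averaging recurrences\<close>

text \<open>Since \<open>c t \<ge> 1 / 2\<close>, the homogeneous solutions decay at least like \<open>1 / sqrt t\<close>, while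
  the constant \<open>2 * \<delta>\<close> absorbs the perturbation.\<close>

lemma averaging_recurrence_error_bound:
  fixes e c \<epsilon> :: "nat \<Rightarrow> real" and \<delta> :: real
  assumes rec: "\<And>t. t \<ge> T \<Longrightarrow> e (Suc t) = e t * (1 - c t / real (Suc t)) + \<epsilon> t / real (Suc t)"
    and c: "\<And>t. t \<ge> T \<Longrightarrow> 1 / 2 \<le> c t \<and> c t \<le> real (Suc t)"
    and \<epsilon>: "\<And>t. t \<ge> T \<Longrightarrow> \<bar>\<epsilon> t\<bar> \<le> \<delta>"
    and t: "t \<ge> T"
  shows "\<bar>e t\<bar> \<le> 2 * \<delta> + \<bar>e T\<bar> * sqrt (real (Suc T)) / sqrt (real (Suc t))"
  using t
proof (induction t rule: dec_induct)
  case base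
  have "0 \<le> \<delta>" using \<epsilon>[of T] by force
  then show ?case by simp
next
  case (step t)
  define K where "K = \<bar>e T\<bar> * sqrt (real (Suc T))"
  define s where "s = real (Suc t)"
  have s: "s \<ge> 1" and s1: "real (Suc (Suc t)) = s + 1" by (auto simp: s_def)
  have K: "K \<ge> 0" and \<delta>: "\<delta> \<ge> 0" using \<epsilon>[of T] by (auto simp: K_def)
  \<comment> \<open>The upper bound on \<open>c t\<close> keeps the factor nonnegative; the lower
    bound makes it a contraction.\<close>
  have "1 / 2 / s \<le> c t / s" "c t / s \<le> 1"
    using c[of t] step.hyps s divide_right_mono[of "1 / 2" "c t" s] by (simp_all add: s_def)
  then have c1: "0 \<le> 1 - c t / s" "1 - c t / s \<le> 1 - 1 / (2 * s)"
    by simp_all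
  \<comment> \<open>The contraction takes \<open>1 / sqrt s\<close> to at most
    \<open>1 / sqrt (s + 1)\<close>, so the transient part of the bound survives one step.\<close>
  have "sqrt (s + 1) * (1 - 1 / (2 * s)) \<le> sqrt s"
  proof (rule real_le_rsqrt)
    have "(sqrt (s + 1) * (1 - 1 / (2 * s)))\<^sup>2 = (s + 1) * (1 - 1 / (2 * s))\<^sup>2"
      using s by (simp add: power_mult_distrib)
    also have "\<dots> = s - (3 * s - 1) / (4 * s\<^sup>2)"
      using s by (simp add: power2_eq_square divide_simps) (simp add: algebra_simps)
    also have "\<dots> \<le> s" using s by simp
    finally show "(sqrt (s + 1) * (1 - 1 / (2 * s)))\<^sup>2 \<le> s" .
  qed
  then have decay: "1 / sqrt s * (1 - 1 / (2 * s)) \<le> 1 / sqrt (s + 1)"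
    using s by (simp add: field_simps)
  have "\<bar>e (Suc t)\<bar> \<le> \<bar>e t\<bar> * (1 - c t / s) + \<bar>\<epsilon> t\<bar> / s"
    using rec[of t] step.hyps c1(1) s abs_triangle_ineq[of "e t * (1 - c t / s)" "\<epsilon> t / s"]
    by (simp add: abs_mult s_def)
  also have "\<dots> \<le> (2 * \<delta> + K / sqrt s) * (1 - 1 / (2 * s)) + \<delta> / s"
    using step.IH step.hyps c1 K \<delta> s \<epsilon>[of t]
    by (intro add_mono mult_mono divide_right_mono) (auto simp: K_def s_def)
  \<comment> \<open>The constant reproduces itself: the contraction removes
    \<open>\<delta> / s\<close> from \<open>2 * \<delta>\<close>, exactly what the perturbation
    adds.\<close>
  also have "\<dots> = 2 * \<delta> + K * (1 / sqrt s * (1 - 1 / (2 * s)))"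
    using s by (simp add: field_simps)
  also have "\<dots> \<le> 2 * \<delta> + K * (1 / sqrt (s + 1))"
    using decay K by (intro add_left_mono mult_left_mono) auto
  finally show ?case by (simp add: K_def s_def s1 add_ac)
qed

text \<open>At \<open>\<beta> / C\<close> the limiting loss balances the limiting input. The
  deviation from this value obeys the same recurrence with input
  \<open>b t - c t * (\<beta> / C)\<close>, which tends to 0, so the error bound applies from a late
  enough start.\<close>

lemma averaging_recurrence_tendsto:
  fixes u b c :: "nat \<Rightarrow> real" and \<beta> C :: real
  assumes rec: "\<And>t. t \<ge> T \<Longrightarrow> u (Suc t) = u t * (1 - c t / real (Suc t)) + b t / real (Suc t)"
    and c: "c \<longlonglongrightarrow> C" and b: "b \<longlonglongrightarrow> \<beta>" and C: "C > 1 / 2"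
  shows "u \<longlonglongrightarrow> \<beta> / C"
proof (rule LIMSEQ_I)
  fix \<eta> :: real assume \<eta>: "\<eta> > 0"
  define x where "x = \<beta> / C"
  define e where "e = (\<lambda>t. u t - x)"
  define \<epsilon> where "\<epsilon> = (\<lambda>t. b t - c t * x)"
  have "\<epsilon> \<longlonglongrightarrow> \<beta> - C * x"
    unfolding \<epsilon>_def by (intro tendsto_intros b c)
  then have "\<epsilon> \<longlonglongrightarrow> 0" using C by (simp add: x_def)
  \<comment> \<open>The error bound doubles \<open>\<eta> / 4\<close>; the transient term gets the
    other half of \<open>\<eta>\<close>.\<close>
  then have ev1: "\<forall>\<^sub>F t in sequentially. \<bar>\<epsilon> t\<bar> < \<eta> / 4"
    using \<eta> by (auto simp: tendsto_iff dist_real_def dest: spec[of _ "\<eta> / 4"])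
  have ev2: "\<forall>\<^sub>F t in sequentially. 1 / 2 < c t"
    using c C by (rule order_tendstoD)
  have "\<forall>\<^sub>F t in sequentially. c t < C + 1"
    using c by (rule order_tendstoD) simp
  moreover have "\<forall>\<^sub>F t in sequentially. C + 1 \<le> real (Suc t)" by real_asymp
  ultimately have ev3: "\<forall>\<^sub>F t in sequentially. c t \<le> real (Suc t)"
    by eventually_elim simp
  obtain T1 where T1: "\<And>t. t \<ge> T1 \<Longrightarrow> \<bar>\<epsilon> t\<bar> < \<eta> / 4 \<and> 1 / 2 < c t \<and> c t \<le> real (Suc t)"
    using eventually_conj[OF ev1 eventually_conj[OF ev2 ev3]]
    by (auto simp: eventually_sequentially)
  define T2 where "T2 = max T T1"
  have bound: "\<bar>e t\<bar> \<le> 2 * (\<eta> / 4) + \<bar>e T2\<bar> * sqrt (real (Suc T2)) / sqrt (real (Suc t))"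
    if "t \<ge> T2" for t
  proof (rule averaging_recurrence_error_bound[where c = c and \<epsilon> = \<epsilon>])
    fix t assume t: "t \<ge> T2"
    then show "e (Suc t) = e t * (1 - c t / real (Suc t)) + \<epsilon> t / real (Suc t)"
      using rec[of t] by (simp add: e_def \<epsilon>_def T2_def divide_simps) (simp add: algebra_simps)
    show "1 / 2 \<le> c t \<and> c t \<le> real (Suc t)" "\<bar>\<epsilon> t\<bar> \<le> \<eta> / 4"
      using T1[of t] t by (auto simp: T2_def)
  qed (use that in simp)
  have "(\<lambda>t. \<bar>e T2\<bar> * sqrt (real (Suc T2)) / sqrt (real (Suc t))) \<longlonglongrightarrow> 0" by real_asymp
  then have "\<forall>\<^sub>F t in sequentially. \<bar>e T2\<bar> * sqrt (real (Suc T2)) / sqrt (real (Suc t)) < \<eta> / 2"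
    using \<eta> by (intro order_tendstoD) auto
  moreover have "\<forall>\<^sub>F t in sequentially. t \<ge> T2" by (rule eventually_ge_at_top)
  ultimately have "\<forall>\<^sub>F t in sequentially. norm (u t - \<beta> / C) < \<eta>"
  proof eventually_elim
    case (elim t)
    then have "\<bar>e t\<bar> < \<eta>" using bound[of t] by linarith
    then show ?case by (simp add: e_def x_def)
  qed
  then show "\<exists>no. \<forall>n\<ge>no. norm (u n - \<beta> / C) < \<eta>"
    by (simp add: eventually_sequentially)
qed

section \<open>Expected numbers of chains in a state\<close>

text \<open>A state of positive probability never lies above the maximum, so the cut-off at the maximal
  value can be dropped, i.e. replaced by \<open>\<infinity>\<close>.\<close>

lemma growing_transition_occupied:
  assumes "measure \<mu> {\<omega> \<in> space \<mu>. Y \<omega> = k} > 0"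
  shows "growing_transition (max_value \<mu> Y) m' f r t k l = growing_transition \<infinity> m' f r t k l"
proof -
  have "enat k \<le> max_value \<mu> Y"
    unfolding max_value_def by (rule SUP_upper) (use assms in simp)
  then show ?thesis by (simp add: growing_transition_def)
qed

text \<open>On the scale \<open>1 / t\<close> only unit jumps survive: the longer ones have finitely
  many lengths, so their rates vanish even when added up.\<close>

lemma scaled_growing_transition_tendsto:
  assumes f: "\<And>k. (\<lambda>t. real t * f t k) \<longlonglongrightarrow> F k"
    and r: "\<And>k l. k + 1 < l \<Longrightarrow> l \<le> k + m' \<Longrightarrow> (\<lambda>t. real t * r k l t) \<longlonglongrightarrow> 0"
  shows "k \<noteq> l \<Longrightarrow> (\<lambda>t. real t * growing_transition \<infinity> m' f r t k l) \<longlonglongrightarrow> (if l = Suc k then F k else 0)"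
    and "(\<lambda>t. real t * (1 - growing_transition \<infinity> m' f r t k k)) \<longlonglongrightarrow> F k"
proof -
  show "(\<lambda>t. real t * growing_transition \<infinity> m' f r t k l) \<longlonglongrightarrow> (if l = Suc k then F k else 0)" if "k \<noteq> l"
    using that f[of k] r[of k l]
    by (cases "k + 1 < l \<and> l \<le> k + m'") (auto simp: growing_transition_def)
  have "(\<lambda>t. real t * f t k + (\<Sum>s = k + 2..k + m'. real t * r k s t)) \<longlonglongrightarrow> F k + (\<Sum>s = k + 2..k + m'. 0)"
    by (intro tendsto_intros f r) auto
  then show "(\<lambda>t. real t * (1 - growing_transition \<infinity> m' f r t k k)) \<longlonglongrightarrow> F k"
    by (simp add: growing_transition_def algebra_simps sum_distrib_left)
qed

text \<open>Monotonicity leaves only finitely many predecessors of \<open>l\<close>, so total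
  probability is a finite sum. At a state where \<open>Y\<close> has no mass both sides of the joint
  identity are 0, whatever \<open>g k\<close> is.\<close>

lemma (in prob_space) prob_one_step_nondecreasing:
  fixes Y Z :: "'a \<Rightarrow> nat"
  assumes Y: "Y \<in> measurable M (count_space UNIV)" and Z: "Z \<in> measurable M (count_space UNIV)"
    and le: "AE \<omega> in M. Y \<omega> \<le> Z \<omega>"
    and trans: "\<And>k. \<P>(\<omega> in M. Y \<omega> = k) > 0 \<Longrightarrow> \<P>(\<omega> in M. Z \<omega> = l \<bar> Y \<omega> = k) = g k"
  shows "\<P>(\<omega> in M. Z \<omega> = l) = (\<Sum>k\<le>l. \<P>(\<omega> in M. Y \<omega> = k) * g k)"
proof -
  note [measurable] = Y Z
  have joint: "\<P>(\<omega> in M. Z \<omega> = l \<and> Y \<omega> = k) = \<P>(\<omega> in M. Y \<omega> = k) * g k" for k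
  proof (cases "\<P>(\<omega> in M. Y \<omega> = k) > 0")
    case True
    then show ?thesis using trans[OF True] by (simp add: cond_prob_def field_simps)
  next
    case False
    then have 0: "\<P>(\<omega> in M. Y \<omega> = k) = 0"
      by (simp add: not_less measure_le_0_iff)
    have "\<P>(\<omega> in M. Z \<omega> = l \<and> Y \<omega> = k) \<le> \<P>(\<omega> in M. Y \<omega> = k)"
      by (intro finite_measure_mono) auto
    then show ?thesis using 0 by (simp add: measure_le_0_iff)
  qed
  have "\<P>(\<omega> in M. Z \<omega> = l) = \<P>(\<omega> in M. Z \<omega> = l \<and> Y \<omega> \<le> l)"
    using le by (intro prob_eq_AE) auto
  also have "{\<omega> \<in> space M. Z \<omega> = l \<and> Y \<omega> \<le> l} = (\<Union>k\<le>l. {\<omega> \<in> space M. Z \<omega> = l \<and> Y \<omega> = k})"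
    by auto
  also have "prob \<dots> = (\<Sum>k\<le>l. \<P>(\<omega> in M. Z \<omega> = l \<and> Y \<omega> = k))"
    by (intro finite_measure_finite_Union) (auto simp: disjoint_family_on_def)
  finally show ?thesis by (simp add: joint)
qed


text \<open>The transition function does not depend on \<open>i\<close>, so the one-step equations
  can be added over all chains; the chain born at \<open>Suc t\<close> contributes its initial
  weight. The last conclusion holds because \<open>f t k\<close> is a conditional probability at
  occupied states; it serves the states below \<open>m\<close>, where the limit \<open>F\<close> may
  be negative.\<close>

lemma degree_counts_recurrence:
  assumes X: "growing_network_chains \<mu> X d f r"
  obtains i\<^sub>0 m' where "i\<^sub>0 \<ge> 1"
    "\<forall>k l. k + 1 < l \<and> l \<le> k + m' \<longrightarrow> (\<lambda>t. real t * r k l t) \<longlonglongrightarrow> 0"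
    "\<forall>t\<ge>i\<^sub>0. \<forall>l. (\<Sum>i = i\<^sub>0..Suc t. \<P>(\<omega> in \<mu>. X i (Suc t) \<omega> = l)) =
       (\<Sum>k\<le>l. (\<Sum>i = i\<^sub>0..t. \<P>(\<omega> in \<mu>. X i t \<omega> = k)) * growing_transition \<infinity> m' f r t k l) + d l (Suc t)"
    "\<forall>i\<ge>i\<^sub>0. \<forall>t\<ge>i. \<forall>k. f t k < 0 \<longrightarrow> \<P>(\<omega> in \<mu>. X i t \<omega> = k) = 0"
proof -
  obtain i0 m' where i0: "i0 \<ge> 1"
    and "\<forall>i\<ge>i0. \<forall>k. \<P>(\<omega> in \<mu>. X i i \<omega> = k) = d k i"
    and "\<forall>i\<ge>i0. \<forall>t\<ge>i. \<forall>k l. \<P>(\<omega> in \<mu>. X i t \<omega> = k) > 0 \<longrightarrow>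
           \<P>(\<omega> in \<mu>. X i (t + 1) \<omega> = l \<bar> X i t \<omega> = k)
             = growing_transition (max_value \<mu> (X i t)) m' f r t k l"
    and r: "\<forall>k l. k + 1 < l \<and> l \<le> k + m' \<longrightarrow> (\<lambda>t. real t * r k l t) \<longlonglongrightarrow> 0"
    using X unfolding growing_network_chains_def by (elim conjE exE) (rule that)
  then have init: "\<And>i k. i \<ge> i0 \<Longrightarrow> \<P>(\<omega> in \<mu>. X i i \<omega> = k) = d k i"
    and trans: "\<And>i t k l. i \<ge> i0 \<Longrightarrow> t \<ge> i \<Longrightarrow> \<P>(\<omega> in \<mu>. X i t \<omega> = k) > 0 \<Longrightarrow>
           \<P>(\<omega> in \<mu>. X i (t + 1) \<omega> = l \<bar> X i t \<omega> = k)
             = growing_transition (max_value \<mu> (X i t)) m' f r t k l"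
    by simp_all
  interpret prob_space \<mu> using X by (simp add: growing_network_chains_def)
  have meas: "X i t \<in> measurable \<mu> (count_space UNIV)" if "i \<ge> i0" "t \<ge> i" for i t
    using X that i0 by (simp add: growing_network_chains_def markov_chain_from_def)
  have mono: "AE \<omega> in \<mu>. X i t \<omega> \<le> X i (t + 1) \<omega>" if "i \<ge> i0" "t \<ge> i" for i t
    using X that i0 by (simp add: growing_network_chains_def)
  have step: "\<P>(\<omega> in \<mu>. X i (Suc t) \<omega> = l) =
      (\<Sum>k\<le>l. \<P>(\<omega> in \<mu>. X i t \<omega> = k) * growing_transition \<infinity> m' f r t k l)"
    if "i \<ge> i0" "t \<ge> i" for i t l
  proof (rule prob_one_step_nondecreasing)
    show "AE \<omega> in \<mu>. X i t \<omega> \<le> X i (Suc t) \<omega>" using mono[OF that] by simp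
    fix k assume "\<P>(\<omega> in \<mu>. X i t \<omega> = k) > 0"
    then show "\<P>(\<omega> in \<mu>. X i (Suc t) \<omega> = l \<bar> X i t \<omega> = k)
        = growing_transition \<infinity> m' f r t k l"
      using trans[OF that, of k l] growing_transition_occupied[of \<mu> "X i t" k m' f r t l] by simp
  qed (use that in \<open>simp_all add: meas\<close>)
  have sums: "(\<Sum>i = i0..Suc t. \<P>(\<omega> in \<mu>. X i (Suc t) \<omega> = l)) =
      (\<Sum>k\<le>l. (\<Sum>i = i0..t. \<P>(\<omega> in \<mu>. X i t \<omega> = k)) * growing_transition \<infinity> m' f r t k l) + d l (Suc t)"
    if t: "t \<ge> i0" for t l
  proof -
    have "(\<Sum>i = i0..t. \<P>(\<omega> in \<mu>. X i (Suc t) \<omega> = l)) =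
        (\<Sum>i = i0..t. \<Sum>k\<le>l. \<P>(\<omega> in \<mu>. X i t \<omega> = k) * growing_transition \<infinity> m' f r t k l)"
      by (intro sum.cong) (auto simp: step)
    also have "\<dots> = (\<Sum>k\<le>l. (\<Sum>i = i0..t. \<P>(\<omega> in \<mu>. X i t \<omega> = k)) * growing_transition \<infinity> m' f r t k l)"
      by (subst sum.swap) (simp add: sum_distrib_right)
    finally show ?thesis using t by (simp add: init)
  qed
  have unoccupied: "\<P>(\<omega> in \<mu>. X i t \<omega> = k) = 0" if "t \<ge> i" "i \<ge> i0" "f t k < 0" for t i k
  proof (rule ccontr)
    assume "\<P>(\<omega> in \<mu>. X i t \<omega> = k) \<noteq> 0"
    then have pos: "\<P>(\<omega> in \<mu>. X i t \<omega> = k) > 0"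
      by (simp add: zero_less_measure_iff)
    have "\<P>(\<omega> in \<mu>. X i (t + 1) \<omega> = k + 1 \<bar> X i t \<omega> = k) = f t k"
      using trans[OF \<open>i \<ge> i0\<close> \<open>t \<ge> i\<close> pos, of "k + 1"]
      by (simp only: growing_transition_occupied[OF pos]) (simp add: growing_transition_def)
    then show False using \<open>f t k < 0\<close> 
      by (metis cond_prob_def divide_nonneg_nonneg measure_nonneg not_less)
  qed
  show ?thesis using that[OF i0 r] sums unoccupied by simp
qed

section \<open>Existence of the limiting degree distribution\<close>

text \<open>The finitely many early chains contribute a bounded amount to the count, which division
  by \<open>t\<close> removes.\<close>

lemma degree_freq_tail_tendsto_iff:
  assumes "prob_space \<mu>" "i\<^sub>0 \<ge> 1"
  shows "(\<lambda>t. degree_freq \<mu> X k t) \<longlonglongrightarrow> x \<longleftrightarrow>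
    (\<lambda>t. (\<Sum>i = i\<^sub>0..t. \<P>(\<omega> in \<mu>. X i t \<omega> = k)) / real t) \<longlonglongrightarrow> x"
proof -
  interpret prob_space \<mu> by fact
  define R where "R = (\<lambda>t. \<Sum>i = 1..<i\<^sub>0. \<P>(\<omega> in \<mu>. X i t \<omega> = k))"
  have "(\<lambda>t. R t / real t) \<longlonglongrightarrow> 0"
  proof (rule tendsto_sandwich[where f = "\<lambda>_. 0" and h = "\<lambda>t. real (card {1..<i\<^sub>0}) / real t"])
    have "0 \<le> R t / real t \<and> R t / real t \<le> real (card {1..<i\<^sub>0}) / real t" for t
      unfolding R_def
      using sum_bounded_above[of "{1..<i\<^sub>0}" "\<lambda>i. \<P>(\<omega> in \<mu>. X i t \<omega> = k)" 1]
      by (auto intro!: divide_right_mono divide_nonneg_nonneg sum_nonneg)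
    then show "\<forall>\<^sub>F t in sequentially. 0 \<le> R t / real t"
      "\<forall>\<^sub>F t in sequentially. R t / real t \<le> real (card {1..<i\<^sub>0}) / real t" by auto
    show "(\<lambda>t. real (card {1..<i\<^sub>0}) / real t) \<longlonglongrightarrow> 0" by real_asymp
  qed simp
  moreover have "degree_freq \<mu> X k t - (\<Sum>i = i\<^sub>0..t. \<P>(\<omega> in \<mu>. X i t \<omega> = k)) / real t = R t / real t"
    if "t \<ge> i\<^sub>0" for t
  proof -
    have "{1..t} = {1..<i\<^sub>0} \<union> {i\<^sub>0..t}" using that assms(2) by auto
    then have "(\<Sum>i = 1..t. \<P>(\<omega> in \<mu>. X i t \<omega> = k)) = R t + (\<Sum>i = i\<^sub>0..t. \<P>(\<omega> in \<mu>. X i t \<omega> = k))"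
      unfolding R_def by (simp only:) (rule sum.union_disjoint, auto)
    then show ?thesis by (simp add: degree_freq_def add_divide_distrib)
  qed
  ultimately have "(\<lambda>t. degree_freq \<mu> X k t - (\<Sum>i = i\<^sub>0..t. \<P>(\<omega> in \<mu>. X i t \<omega> = k)) / real t) \<longlonglongrightarrow> 0"
    by (subst tendsto_cong[where g = "\<lambda>t. R t / real t"])
      (auto simp: eventually_sequentially intro!: exI[of _ i\<^sub>0])
  then show ?thesis by (rule Lim_transform_eq)
qed

text \<open>Strong induction on the state: the normalised count of \<open>l\<close> obeys an
  averaging recurrence whose input comes from newborn chains and from lower states, whose limits are
  already known.\<close>

lemma degree_freq_tendsto:
  assumes X: "growing_network_chains \<mu> X d f r"
    and d: "\<And>k. (\<lambda>i. d k i) \<longlonglongrightarrow> dl k"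
    and F: "\<And>k. (\<lambda>t. real t * f t k) \<longlonglongrightarrow> F k"
    and dl0: "\<And>k. k < m \<Longrightarrow> dl k = 0" and F_pos: "\<And>k. k \<ge> m \<Longrightarrow> F k > 0"
  obtains p where "\<And>k. (\<lambda>t. degree_freq \<mu> X k t) \<longlonglongrightarrow> p k"
    "\<And>k. k < m \<Longrightarrow> p k = 0" "(1 + F m) * p m = dl m"
    "\<And>k. k \<ge> m \<Longrightarrow> (1 + F (Suc k)) * p (Suc k) = F k * p k + dl (Suc k)"
proof -
  have ps: "prob_space \<mu>" using X by (simp add: growing_network_chains_def)
  obtain i0 m' where i0: "i0 \<ge> 1"
    and r: "\<forall>k l. k + 1 < l \<and> l \<le> k + m' \<longrightarrow> (\<lambda>t. real t * r k l t) \<longlonglongrightarrow> 0"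
    and counts: "\<forall>t\<ge>i0. \<forall>l. (\<Sum>i = i0..Suc t. \<P>(\<omega> in \<mu>. X i (Suc t) \<omega> = l)) =
       (\<Sum>k\<le>l. (\<Sum>i = i0..t. \<P>(\<omega> in \<mu>. X i t \<omega> = k)) * growing_transition \<infinity> m' f r t k l) + d l (Suc t)"
    and unoccupied: "\<forall>i\<ge>i0. \<forall>t\<ge>i. \<forall>k. f t k < 0 \<longrightarrow> \<P>(\<omega> in \<mu>. X i t \<omega> = k) = 0"
    by (rule degree_counts_recurrence[OF X])
  define G where "G = growing_transition \<infinity> m' f r"
  define S where "S = (\<lambda>k t. \<Sum>i = i0..t. \<P>(\<omega> in \<mu>. X i t \<omega> = k))"
  define u where "u = (\<lambda>k t. S k t / real t)"
  have G_jump: "(\<lambda>t. real t * G t k l) \<longlonglongrightarrow> (if l = Suc k then F k else 0)" if "k < l" for k l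
    unfolding G_def using that by (intro scaled_growing_transition_tendsto(1) F) (use r that in auto)
  have G_stay: "(\<lambda>t. real t * (1 - G t k k)) \<longlonglongrightarrow> F k" for k
    unfolding G_def by (intro scaled_growing_transition_tendsto(2) F) (use r in auto)
  have "\<exists>x. u l \<longlonglongrightarrow> x \<and> (l < m \<longrightarrow> x = 0) \<and>
      (m \<le> l \<longrightarrow> (1 + F l) * x = (if l = m then 0 else F (l - 1) * lim (u (l - 1))) + dl l)" for l
  proof (induction l rule: less_induct)
    case (less l)
    show ?case
    proof (cases "F l < 0")
      case True
      \<comment> \<open>Then \<open>f t l < 0\<close> for large \<open>t\<close>, which cannot be a transition probability: state \<open>l\<close> must
        be empty.\<close>
      then have "l < m" using F_pos[of l] by fastforce
      have "\<forall>\<^sub>F t in sequentially. real t * f t l < 0"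
        using F[of l] True by (rule order_tendstoD)
      then have "\<forall>\<^sub>F t in sequentially. u l t = 0"
      proof eventually_elim
        case (elim t)
        then have "f t l < 0" by (auto simp: mult_less_0_iff)
        then show ?case by (simp add: u_def S_def unoccupied)
      qed
      then have "u l \<longlonglongrightarrow> 0" by (rule tendsto_eventually)
      then show ?thesis using \<open>l < m\<close> by auto
    next
      case False
      define q where "q = (\<lambda>k. lim (u k))"
      have u_lim: "u k \<longlonglongrightarrow> q k" if "k < l" for k
        unfolding q_def using less[OF that] by (auto simp: limI)
      have q0: "q k = 0" if "k < l" "k < m" for k
        unfolding q_def using less[OF that(1)] that by (auto simp: limI)
      define b where "b = (\<lambda>t. (\<Sum>k<l. u k t * (real t * G t k l)) + d l (Suc t))"
      \<comment> \<open>Chosen so that \<open>real t * G t l l = real (Suc t) - c t\<close>. The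
        summand 1 is the effect of normalising by \<open>Suc t\<close> after one step.\<close>
      define c where "c = (\<lambda>t. 1 + real t * (1 - G t l l))"
      define \<beta> where "\<beta> = (\<Sum>k<l. q k * (if l = Suc k then F k else 0)) + dl l"
      have rec: "u l (Suc t) = u l t * (1 - c t / real (Suc t)) + b t / real (Suc t)" if "t \<ge> i0" for t
      proof -
        have t: "real t > 0" using that i0 by simp
        have "S l (Suc t) = (\<Sum>k<l. S k t * G t k l) + S l t * G t l l + d l (Suc t)"
          using counts that by (simp add: S_def G_def lessThan_Suc_atMost[symmetric])
        also have "\<dots> = real t * u l t * G t l l + b t"
          using t by (simp add: b_def u_def mult_ac)
        finally have "u l (Suc t) = (real t * u l t * G t l l + b t) / real (Suc t)"
          by (simp only: u_def)
        then show ?thesis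
          by (simp add: c_def divide_simps) (simp add: algebra_simps)
      qed
      have "c \<longlonglongrightarrow> 1 + F l"
        unfolding c_def by (intro tendsto_intros G_stay)
      moreover have "b \<longlonglongrightarrow> \<beta>"
        unfolding b_def \<beta>_def
        by (intro tendsto_intros u_lim G_jump LIMSEQ_Suc d) auto
      \<comment> \<open>Here \<open>F l\<close> is nonnegative, so the coefficient tends to at least
        1, above the threshold \<open>1 / 2\<close>.\<close>
      ultimately have conv: "u l \<longlonglongrightarrow> \<beta> / (1 + F l)"
        using False by (intro averaging_recurrence_tendsto[where T = i0 and c = c and b = b] rec) auto
      \<comment> \<open>In the limit only state \<open>l - 1\<close> feeds \<open>l\<close>; state 0
        has no predecessor.\<close>
      have "\<beta> = (if l = 0 then 0 else F (l - 1) * q (l - 1)) + dl l"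
        unfolding \<beta>_def by (cases l) (simp_all add: mult.commute)
      \<comment> \<open>This covers \<open>l = m\<close> too: its predecessor is empty in the limit,
        so \<open>dl m\<close> is its only input.\<close>
      moreover have "q (l - 1) = 0" if "0 < l" "l \<le> m" using that by (intro q0) auto
      ultimately have "l < m \<Longrightarrow> \<beta> = 0"
        and "m \<le> l \<Longrightarrow> \<beta> = (if l = m then 0 else F (l - 1) * lim (u (l - 1))) + dl l"
        using dl0[of l] by (auto simp: q_def)
      then show ?thesis using conv False by (intro exI[of _ "\<beta> / (1 + F l)"]) auto
    qed
  qed
  then have u: "u l \<longlonglongrightarrow> lim (u l)" "l < m \<Longrightarrow> lim (u l) = 0"
    "m \<le> l \<Longrightarrow> (1 + F l) * lim (u l) = (if l = m then 0 else F (l - 1) * lim (u (l - 1))) + dl l" for l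
    by (metis limI)+
  show ?thesis
  proof (rule that)
    show "(\<lambda>t. degree_freq \<mu> X k t) \<longlonglongrightarrow> lim (u k)" for k
      using u(1)[of k] degree_freq_tail_tendsto_iff[OF ps i0] by (simp add: u_def S_def)
    show "(1 + F m) * lim (u m) = dl m" using u(3)[of m] by simp
    show "(1 + F (Suc k)) * lim (u (Suc k)) = F k * lim (u k) + dl (Suc k)" if "k \<ge> m" for k
      using u(3)[of "Suc k"] that by simp
  qed (rule u(2))
qed

section \<open>Products of affine ratios and their asymptotics\<close>

text \<open>In the quotient of the two series for \<open>Gamma\<close> the factorials cancel,
  leaving a power of \<open>n\<close> and the Pochhammer ratio.\<close>

lemma pochhammer_ratio_tendsto:
  fixes z w :: real
  assumes "z > 0" "w > 0"
  shows "(\<lambda>n. real n powr (w - z) * (pochhammer z n / pochhammer w n)) \<longlonglongrightarrow> Gamma w / Gamma z"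
proof -
  have pos: "pochhammer z n > 0" "pochhammer w n > 0" for n
    using assms by (auto intro: pochhammer_pos)
  have "(\<lambda>n. Gamma_series' w n / Gamma_series' z n) \<longlonglongrightarrow> Gamma w / Gamma z"
    using assms by (intro tendsto_divide Gamma_series'_LIMSEQ) (simp add: Gamma_real_pos less_imp_neq[symmetric])
  moreover have "Gamma_series' w n / Gamma_series' z n = real n powr (w - z) * (pochhammer z n / pochhammer w n)"
    if "n > 0" for n
    using that pos[of n]
    by (simp add: Gamma_series'_def powr_def left_diff_distrib exp_diff field_simps)
  ultimately show ?thesis
    by (subst tendsto_cong[where g = "\<lambda>n. Gamma_series' w n / Gamma_series' z n"])
      (auto intro: eventually_mono[OF eventually_gt_at_top[of 0]])
qed

text \<open>Dividing numerator and denominator of each factor by \<open>A\<close> leaves unit shifts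
  of two fixed parameters.\<close>

lemma prod_affine_ratio:
  fixes A B :: real
  assumes "A > 0"
  shows "(\<Prod>i = k..<k + n. (A * real i + B) / (1 + A * real (i + 1) + B)) =
    pochhammer (real k + B / A) n / pochhammer (real k + B / A + 1 + 1 / A) n"
proof (induction n)
  case (Suc n)
  have "A * real (k + n) + B = A * (real k + B / A + real n)"
    "1 + A * real (k + n + 1) + B = A * (real k + B / A + 1 + 1 / A + real n)"
    using assms by (simp_all add: field_simps)
  then have "(A * real (k + n) + B) / (1 + A * real (k + n + 1) + B)
      = (real k + B / A + real n) / (real k + B / A + 1 + 1 / A + real n)"
    using assms by simp
  then show ?case using Suc by (simp add: pochhammer_Suc)
qed simp

section \<open>The linear recurrence for the limits\<close>

locale degree_recurrence =
  fixes p F dl :: "nat \<Rightarrow> real" and m :: nat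
  assumes F_pos: "k \<ge> m \<Longrightarrow> F k > 0"
    and p_below: "k < m \<Longrightarrow> p k = 0"
    and p_base: "(1 + F m) * p m = dl m"
    and p_step: "k \<ge> m \<Longrightarrow> (1 + F (Suc k)) * p (Suc k) = F k * p k + dl (Suc k)"
begin

lemma p_base_eq: "p m = dl m / (1 + F m)"
  using p_base F_pos[of m] by (simp add: field_simps)

lemma p_step_eq: "k \<ge> m \<Longrightarrow> p (Suc k) = F k / (1 + F (Suc k)) * p k + dl (Suc k) / (1 + F (Suc k))"
  using p_step[of k] F_pos[of "Suc k"]
  by (simp add: add_divide_distrib[symmetric] nonzero_eq_divide_eq mult.commute)

lemma p_pos:
  assumes "\<And>k. dl k \<ge> 0" "dl m > 0" "k \<ge> m"
  shows "p k > 0"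
  using \<open>k \<ge> m\<close>
proof (induction k rule: dec_induct)
  case base
  then show ?case using F_pos[of m] assms by (simp add: p_base_eq)
next
  case (step k)
  then show ?case using F_pos[of k] F_pos[of "Suc k"] assms(1)[of "Suc k"]
    by (simp add: p_step_eq add_pos_nonneg)
qed

text \<open>The recurrence telescopes: internal flows cancel, and \<open>F n * p n\<close> is the
  flux leaving through the top state.\<close>

lemma mass_balance:
  assumes "n \<ge> m"
  shows "sum p {m..n} + F n * p n = sum dl {m..n}"
  using assms
proof (induction n rule: dec_induct)
  case base
  then show ?case using p_base by (simp add: algebra_simps)
next
  case (step n)
  then show ?case using p_step[of n] by (simp add: algebra_simps)
qed

text \<open>By the mass balance, the partial sums of \<open>p\<close> and \<open>dl\<close> differ
  exactly by the flux.\<close>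

lemma p_sums:
  assumes "dl sums s" "\<And>k. k < m \<Longrightarrow> dl k = 0" "(\<lambda>n. F n * p n) \<longlonglongrightarrow> 0"
  shows "p sums s"
proof -
  have "sum g {..n} = sum g {m..n}" if "\<And>k. k < m \<Longrightarrow> g k = 0" "n \<ge> m" for g :: "nat \<Rightarrow> real" and n
    using that by (intro sum.mono_neutral_right) auto
  then have "sum p {..n} = sum dl {..n} - F n * p n" if "n \<ge> m" for n
    using that mass_balance[of n] p_below assms(2) by simp
  moreover have "(\<lambda>n. sum dl {..n} - F n * p n) \<longlonglongrightarrow> s - 0"
    using assms by (intro tendsto_diff) (auto simp: sums_def_le)
  ultimately show ?thesis
    unfolding sums_def_le
    by (subst tendsto_cong[where g = "\<lambda>n. sum dl {..n} - F n * p n"])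
      (auto intro: eventually_mono[OF eventually_ge_at_top[of m]])
qed

text \<open>Variation of constants: the product solves the homogeneous recurrence, and the bracket
  collects each source divided by the homogeneous solution at its state.\<close>

lemma p_explicit:
  assumes "k \<ge> m"
  shows "p k = (\<Prod>i = m..<k. F i / (1 + F (Suc i))) *
    (dl m / (1 + F m) + (\<Sum>l = m..<k. (dl (Suc l) / (1 + F (Suc l))) / (\<Prod>j = m..l. F j / (1 + F (Suc j)))))"
  using assms
proof (induction k rule: dec_induct)
  case base
  then show ?case by (simp add: p_base_eq)
next
  case (step k)
  have "F j / (1 + F (Suc j)) \<noteq> 0" if "j \<ge> m" for j
    using F_pos[of j] F_pos[of "Suc j"] that by simp
  then have "(\<Prod>j = m..k. F j / (1 + F (Suc j))) \<noteq> 0" by auto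
  moreover have "(\<Prod>j = m..k. F j / (1 + F (Suc j))) = (\<Prod>j = m..<k. F j / (1 + F (Suc j))) * (F k / (1 + F (Suc k)))"
    using step.hyps by (simp add: atLeastLessThanSuc_atLeastAtMost[symmetric])
  ultimately show ?case
    using step by (simp add: p_step_eq distrib_left mult_ac)
qed

lemma p_tail:
  assumes "k \<ge> m" "\<And>l. l > k \<Longrightarrow> dl l = 0"
  shows "p (k + n) = p k * (\<Prod>i = k..<k + n. F i / (1 + F (Suc i)))"
  using assms by (induction n) (simp_all add: p_step_eq)

end

section \<open>Affine rates: tail, decay and flux\<close>

locale affine_degree_recurrence = degree_recurrence +
  fixes A B :: real and M :: nat
  assumes F_affine: "F k = A * real k + B"
    and m_le_M: "m \<le> M" and dl_above: "k > M \<Longrightarrow> dl k = 0"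
begin

lemma p_tail_pochhammer:
  assumes "A > 0" "k \<ge> m" "\<And>l. l > k \<Longrightarrow> dl l = 0"
  shows "p (k + n) = p k * (pochhammer (real k + B / A) n / pochhammer (real k + B / A + 1 + 1 / A) n)"
  using p_tail[OF assms(2,3), of n] prod_affine_ratio[OF \<open>A > 0\<close>, where B = B and k = k and n = n]
  by (simp add: F_affine add_ac)

lemma shift_pos: "A > 0 \<Longrightarrow> k \<ge> m \<Longrightarrow> real k + B / A > 0"
  using F_pos[of k] by (simp add: F_affine field_simps)

text \<open>A Pochhammer symbol is a quotient of two \<open>Gamma\<close> values; positivity of the
  shifted arguments keeps them off the poles.\<close>

lemma p_tail_Gamma:
  assumes "A > 0" "k \<ge> m" "\<And>l. l > k \<Longrightarrow> dl l = 0" "n \<ge> k"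
  shows "p n = (Gamma (real n + B / A) / Gamma (real n + B / A + 1 + 1 / A)) *
    (Gamma (real k + B / A + 1 + 1 / A) / Gamma (real k + B / A)) * p k"
proof -
  have z: "real k + B / A > 0" using shift_pos assms by blast
  have w: "real k + B / A + 1 + 1 / A > 0" using z \<open>A > 0\<close> by (simp add: add_pos_pos)
  have nz: "x \<notin> \<int>\<^sub>\<le>\<^sub>0" if "x > 0" for x :: real using that by (auto elim!: nonpos_Ints_cases)
  have "p n = p k * (pochhammer (real k + B / A) (n - k) / pochhammer (real k + B / A + 1 + 1 / A) (n - k))"
    using p_tail_pochhammer[OF assms(1-3), of "n - k"] \<open>n \<ge> k\<close> by simp
  moreover have "pochhammer (real k + B / A) (n - k) = Gamma (real n + B / A) / Gamma (real k + B / A)"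
    using pochhammer_Gamma[OF nz[OF z], of "n - k"] \<open>n \<ge> k\<close> by (simp add: of_nat_diff add_ac)
  moreover have "pochhammer (real k + B / A + 1 + 1 / A) (n - k)
      = Gamma (real n + B / A + 1 + 1 / A) / Gamma (real k + B / A + 1 + 1 / A)"
    using pochhammer_Gamma[OF nz[OF w], of "n - k"] \<open>n \<ge> k\<close> by (simp add: of_nat_diff algebra_simps)
  ultimately show ?thesis by (simp add: mult_ac)
qed

text \<open>From \<open>M\<close> on, \<open>p\<close> is a multiple of a Pochhammer ratio, and the
  difference \<open>w - z\<close> of its parameters is the exponent.\<close>

lemma p_power_law:
  assumes "A > 0" "p M > 0"
  shows "power_law p (1 + 1 / A)"
proof -
  define z where "z = real M + B / A"
  define w where "w = z + 1 + 1 / A"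
  have z: "z > 0" unfolding z_def by (rule shift_pos[OF \<open>A > 0\<close> m_le_M])
  have w: "w > 0" using z \<open>A > 0\<close> by (simp add: w_def add_pos_pos)
  have wz: "w - z = 1 + 1 / A" by (simp add: w_def)
  define g where "g = (\<lambda>n. real n powr (1 + 1 / A) * (pochhammer z n / pochhammer w n))"
  have "g \<longlonglongrightarrow> Gamma w / Gamma z"
    using pochhammer_ratio_tendsto[OF z w] by (simp add: g_def wz)
  \<comment> \<open>The Pochhammer asymptotics use powers of \<open>n\<close>, the power law powers
    of \<open>n + M\<close>; this factor converts between them.\<close>
  moreover have "(\<lambda>n. (real (n + M) / real n) powr (1 + 1 / A)) \<longlonglongrightarrow> 1" by real_asymp
  ultimately have "(\<lambda>n. (real (n + M) / real n) powr (1 + 1 / A) * g n * p M) \<longlonglongrightarrow> 1 * (Gamma w / Gamma z) * p M"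
    by (intro tendsto_mult tendsto_const)
  moreover have "\<forall>\<^sub>F n in sequentially. real (n + M) powr (1 + 1 / A) * p (n + M)
      = (real (n + M) / real n) powr (1 + 1 / A) * g n * p M"
    using eventually_gt_at_top[of 0]
  proof eventually_elim
    case (elim n)
    then show ?case
      using p_tail_pochhammer[OF \<open>A > 0\<close> m_le_M dl_above, of n]
      by (simp add: g_def z_def w_def powr_divide add.commute[of n M])
  qed
  ultimately have "(\<lambda>n. real (n + M) powr (1 + 1 / A) * p (n + M)) \<longlonglongrightarrow> (Gamma w / Gamma z) * p M"
    by (simp add: tendsto_cong)
  then have "(\<lambda>n. real n powr (1 + 1 / A) * p n) \<longlonglongrightarrow> (Gamma w / Gamma z) * p M"
    by (rule LIMSEQ_offset)
  moreover have "(Gamma w / Gamma z) * p M > 0"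
    using z w assms by (simp add: Gamma_real_pos)
  ultimately show ?thesis by (auto simp: power_law_def)
qed

lemma p_geometric:
  assumes "A = 0"
  shows "p (n + M) = p M * (B / (1 + B)) ^ n"
  using p_tail[OF m_le_M dl_above, of n] assms by (simp add: F_affine add.commute)

text \<open>Beyond \<open>M\<close> the decay is geometric with ratio strictly between 0 and 1,
  which beats every power and forces the limit 0 in place of a positive constant.\<close>

lemma not_power_law:
  assumes "A = 0" "p M > 0"
  shows "\<not> power_law p \<gamma>"
proof
  assume "power_law p \<gamma>"
  then obtain c where "c > 0" and c: "(\<lambda>k. real k powr \<gamma> * p k) \<longlonglongrightarrow> c"
    by (auto simp: power_law_def)
  define q where "q = B / (1 + B)"
  have "0 < B" using F_pos[of m] assms by (simp add: F_affine)
  then have q: "0 < q" "q < 1" by (auto simp: q_def)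
  have "(\<lambda>n. real (n + M) powr \<gamma> * q ^ n) \<longlonglongrightarrow> 0" using q by real_asymp
  then have "(\<lambda>n. p M * (real (n + M) powr \<gamma> * q ^ n)) \<longlonglongrightarrow> p M * 0"
    by (intro tendsto_mult tendsto_const)
  then have "(\<lambda>n. real (n + M) powr \<gamma> * p (n + M)) \<longlonglongrightarrow> 0"
    using p_geometric[OF \<open>A = 0\<close>] by (simp add: q_def mult_ac)
  moreover have "(\<lambda>n. real (n + M) powr \<gamma> * p (n + M)) \<longlonglongrightarrow> c"
    using c by (rule LIMSEQ_ignore_initial_segment)
  ultimately show False using LIMSEQ_unique \<open>c > 0\<close> by fastforce
qed

text \<open>A negative slope would make \<open>F k\<close> negative for large \<open>k\<close>,
  against its positivity from \<open>m\<close> on.\<close>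

lemma A_nonneg: "A \<ge> 0"
proof (rule ccontr)
  assume "\<not> A \<ge> 0"
  then have "filterlim (\<lambda>k. A * real k + B) at_bot at_top" by real_asymp
  then have "\<forall>\<^sub>F k in sequentially. A * real k + B < 0" by (simp add: filterlim_at_bot_dense)
  moreover have "\<forall>\<^sub>F k in sequentially. A * real k + B > 0"
    using eventually_ge_at_top[of m] by eventually_elim (use F_pos F_affine in force)
  ultimately have "\<forall>\<^sub>F k in sequentially. False" by eventually_elim simp
  then show False by simp
qed

text \<open>If \<open>A = 0\<close>, \<open>F\<close> is constant and \<open>p\<close> decays
  geometrically. If \<open>A > 0\<close>, \<open>p n\<close> has order
  \<open>n powr - (1 + 1 / A)\<close>, so the linear factor \<open>F n\<close> still leaves order
  \<open>n powr - (1 / A)\<close>.\<close>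

lemma flux_tendsto_0:
  assumes "p M > 0"
  shows "(\<lambda>n. F n * p n) \<longlonglongrightarrow> 0"
proof (cases "A = 0")
  case True
  have "0 < B" using F_pos[of m] True by (simp add: F_affine)
  then have "(\<lambda>n. B * (p M * (B / (1 + B)) ^ n)) \<longlonglongrightarrow> B * (p M * 0)"
    by (intro tendsto_mult tendsto_const LIMSEQ_power_zero) auto
  then have "(\<lambda>n. F (n + M) * p (n + M)) \<longlonglongrightarrow> 0"
    using True by (simp add: F_affine p_geometric)
  then show ?thesis by (rule LIMSEQ_offset)
next
  case False
  then have A: "A > 0" using A_nonneg by simp
  then obtain c where "(\<lambda>k. real k powr (1 + 1 / A) * p k) \<longlonglongrightarrow> c"
    using p_power_law assms by (auto simp: power_law_def)
  moreover have "(\<lambda>n. (A * real n + B) / real n powr (1 + 1 / A)) \<longlonglongrightarrow> 0"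
    using A by real_asymp
  ultimately have "(\<lambda>n. (A * real n + B) / real n powr (1 + 1 / A) * (real n powr (1 + 1 / A) * p n)) \<longlonglongrightarrow> 0 * c"
    by (intro tendsto_mult)
  moreover have "\<forall>\<^sub>F n in sequentially. F n * p n =
      (A * real n + B) / real n powr (1 + 1 / A) * (real n powr (1 + 1 / A) * p n)"
    using eventually_gt_at_top[of 0] by eventually_elim (simp add: F_affine)
  ultimately show ?thesis by (simp add: tendsto_cong)
qed

end

section \<open>Nonnegative newborn weights and assembly of the four claims\<close>

lemma initial_limit_nonneg:
  assumes X: "growing_network_chains \<mu> X d f r" and d: "(\<lambda>i. d k i) \<longlonglongrightarrow> x"
  shows "x \<ge> 0"
proof -
  obtain i0 where "\<forall>i\<ge>i0. \<forall>k. \<P>(\<omega> in \<mu>. X i i \<omega> = k) = d k i"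
    using X unfolding growing_network_chains_def by (elim conjE exE) (rule that)
  then have "d k i \<ge> 0" if "i \<ge> i0" for i
    using that by (metis measure_nonneg)
  then show ?thesis using d by (intro LIMSEQ_le_const) auto
qed

theorem theorem3p5:
  fixes \<mu> :: "'a measure" and X :: "nat \<Rightarrow> nat \<Rightarrow> 'a \<Rightarrow> nat"
    and d :: "nat \<Rightarrow> nat \<Rightarrow> real" and f :: "nat \<Rightarrow> nat \<Rightarrow> real"
    and r :: "nat \<Rightarrow> nat \<Rightarrow> nat \<Rightarrow> real"
    and dl F P :: "nat \<Rightarrow> real" and m M :: nat and A B :: real
  assumes "growing_network_chains \<mu> X d f r"
    and "\<forall>k. (\<lambda>i. d k i) \<longlonglongrightarrow> dl k"
    and "dl sums 1"
    and "\<forall>k. (\<lambda>t. real t * f t k) \<longlonglongrightarrow> F k"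
    and "\<forall>k<m. dl k = 0"
    and "dl m > 0"
    and "\<forall>k\<ge>m. F k > 0"
    and "m \<le> M"
    and "\<forall>k>M. dl k = 0"
    and "\<forall>k. F k = A * real k + B"
    and "\<forall>k. P k = lim (\<lambda>t. degree_freq \<mu> X k t)"
  shows
    "(steady_degree_distribution \<mu> X P \<and> (\<lambda>j. P (m + j)) sums 1) \<and>
     (A > 0 \<longrightarrow>
        scale_free \<mu> X \<and>
        (\<forall>k\<ge>m. P k =
           (if k = m then dl m / (1 + A * real m + B)
            else if k \<le> M then
              (\<Prod>i = m..<k. (A * real i + B) / (1 + A * real (i + 1) + B)) *
              (dl m / (1 + A * real m + B) +
               (\<Sum>l = m..<k. (dl (l + 1) / (1 + A * real (l + 1) + B)) /
                  (\<Prod>j = m..l. (A * real j + B) / (1 + A * real (j + 1) + B))))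
            else
              (Gamma (real k + B / A) / Gamma (real k + B / A + 1 + 1 / A)) *
              (Gamma (real M + B / A + 1 + 1 / A) / Gamma (real M + B / A)) *
              (\<Prod>i = m..<M. (A * real i + B) / (1 + A * real (i + 1) + B)) *
              (dl m / (1 + A * real m + B) +
               (\<Sum>l = m..<M. (dl (l + 1) / (1 + A * real (l + 1) + B)) /
                  (\<Prod>j = m..l. (A * real j + B) / (1 + A * real (j + 1) + B)))))) \<and>
        power_law P (1 + 1 / A) \<and>
        (dl m = 1 \<and> (\<forall>k. k \<noteq> m \<longrightarrow> dl k = 0) \<longrightarrow>
           (\<forall>k\<ge>m. P k =
              (if k = m then 1 / (1 + A * real m + B)
               else
                 (Gamma (real k + B / A) / Gamma (real k + B / A + 1 + 1 / A)) *
                 (Gamma (real m + B / A + 1 + 1 / A) / Gamma (real m + B / A)) *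
                 (1 / (1 + A * real m + B)))) \<and>
           power_law P (1 + 1 / A))) \<and>
     (A = 0 \<and> B > 0 \<longrightarrow> \<not> scale_free \<mu> X) \<and>
     \<not> A < 0 \<and> \<not> (A = 0 \<and> B < 0)"
proof -
  note X = assms(1) and dl_sums = assms(3) and dl_below = assms(5) and dl_m = assms(6)
    and F_pos = assms(7) and m_le_M = assms(8) and dl_above = assms(9) and F_affine = assms(10)
  obtain p where p: "\<And>k. (\<lambda>t. degree_freq \<mu> X k t) \<longlonglongrightarrow> p k"
    "\<And>k. k < m \<Longrightarrow> p k = 0" "(1 + F m) * p m = dl m"
    "\<And>k. k \<ge> m \<Longrightarrow> (1 + F (Suc k)) * p (Suc k) = F k * p k + dl (Suc k)"
    by (rule degree_freq_tendsto[OF X, of dl F m]) (use assms in auto)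
  have "P = p" using assms(11) limI[OF p(1)] by auto
  have lim: "(\<lambda>t. degree_freq \<mu> X k t) \<longlonglongrightarrow> P k" for k
    using p(1) by (simp add: \<open>P = p\<close>)
  interpret affine_degree_recurrence P F dl m A B M
    by unfold_locales (use F_pos m_le_M dl_above F_affine p(2-4) \<open>P = p\<close> in auto)
  have dl_nonneg: "dl k \<ge> 0" for k
    using initial_limit_nonneg[OF X] assms(2) by blast
  have P_pos: "P k > 0" if "k \<ge> m" for k
    using p_pos dl_nonneg dl_m that by blast
  have P_nonneg: "P k \<ge> 0" for k
    using P_pos[of k] p_below[of k] by (cases "k < m") (auto intro: less_imp_le)
  have P_M: "P M > 0" using P_pos m_le_M by blast
  have sums: "P sums 1"
    using dl_sums dl_below flux_tendsto_0[OF P_M] by (intro p_sums) auto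
  then have steady: "steady_degree_distribution \<mu> X P"
    using lim P_nonneg by (auto simp: steady_degree_distribution_def)
  have tail: "(\<lambda>j. P (m + j)) sums 1"
    using sums p_below by (subst add.commute) (simp add: sums_zero_iff_shift)
  have law: "power_law P (1 + 1 / A)" if "A > 0"
    using that P_M by (rule p_power_law)
  \<comment> \<open>Shared by the last two cases of the formula: evaluated at \<open>k\<close> up to
    \<open>M\<close>, and at \<open>M\<close> as the starting value of the tail.\<close>
  define W where "W = (\<lambda>k. (\<Prod>i = m..<k. (A * real i + B) / (1 + A * real (i + 1) + B)) *
      (dl m / (1 + A * real m + B) +
       (\<Sum>l = m..<k. (dl (l + 1) / (1 + A * real (l + 1) + B)) /
          (\<Prod>j = m..l. (A * real j + B) / (1 + A * real (j + 1) + B)))))"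
  have explicit: "P k = W k" if "k \<ge> m" for k
    using p_explicit[OF that] by (simp add: W_def F_affine add.assoc)
  have formula: "P k = (if k = m then dl m / (1 + A * real m + B) else if k \<le> M then W k
      else (Gamma (real k + B / A) / Gamma (real k + B / A + 1 + 1 / A)) *
        (Gamma (real M + B / A + 1 + 1 / A) / Gamma (real M + B / A)) * W M)"
    if "A > 0" "k \<ge> m" for k
    using that p_base_eq explicit p_tail_Gamma[OF \<open>A > 0\<close> m_le_M, of k] dl_above explicit[OF m_le_M]
    by (auto simp: F_affine add.assoc)
  \<comment> \<open>All newborn mass sits at \<open>m\<close>, so the \<open>Gamma\<close> tail can
    start at \<open>m\<close> rather than at \<open>M\<close>.\<close>
  have single: "P k = (if k = m then 1 / (1 + A * real m + B)
      else (Gamma (real k + B / A) / Gamma (real k + B / A + 1 + 1 / A)) *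
        (Gamma (real m + B / A + 1 + 1 / A) / Gamma (real m + B / A)) * (1 / (1 + A * real m + B)))"
    if "A > 0" "k \<ge> m" "dl m = 1" "\<forall>k. k \<noteq> m \<longrightarrow> dl k = 0" for k
    using that p_base_eq p_tail_Gamma[OF \<open>A > 0\<close> order_refl, of k]
    by (auto simp: F_affine add.assoc)
  have not_scale_free: "\<not> scale_free \<mu> X" if "A = 0"
  proof
    assume "scale_free \<mu> X"
    then obtain Q \<gamma> where Q: "steady_degree_distribution \<mu> X Q" "power_law Q \<gamma>"
      by (auto simp: scale_free_def)
    \<comment> \<open>Scale-freeness only asserts some witness; uniqueness of limits identifies it
      with \<open>P\<close>.\<close>
    then have "Q = P"
      using lim by (auto simp: steady_degree_distribution_def intro!: LIMSEQ_unique[OF _ lim])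
    then show False using not_power_law[OF that P_M] Q(2) by blast
  qed
  \<comment> \<open>For \<open>A = 0\<close> the constant \<open>F\<close> equals \<open>B\<close>,
    and positivity at \<open>m\<close> excludes \<open>B < 0\<close>.\<close>
  have "B > 0" if "A = 0" using F_pos F_affine that by force
  moreover have "\<not> A < 0" using A_nonneg by simp
  moreover have "scale_free \<mu> X" if "A > 0"
    using steady law[OF that] by (auto simp: scale_free_def)
  ultimately show ?thesis
    using steady tail law formula single not_scale_free
    unfolding W_def mult.assoc
    by (intro conjI impI allI) (assumption | blast | force)+
qed

end
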